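(* Every $4$-potent ring is commutative; that is, if $R$ is a ring with $x^4=x$ for all $x\in R$, then $R$ is commutative.
   Context: Rings are associative but are not assumed to have a unity. For an integer $n\geq 2$, a ring $R$ is called $n$-potent if $x^n=x$ for all $x\in R$. *)

theory Defs
  imports Main
begin

text \<open>
  The type class \<^class>\<open>ring\<close> is that of associative rings without an assumed unity, so the library
  power operation, which requires a unity, is not available. Only exponents \<open>n \<ge> 1\<close> are
  meaningful below; \<open>pos_power x 0\<close> is the junk value \<open>x\<close>.
\<close>

definition pos_power :: "'a::semigroup_mult \<Rightarrow> nat \<Rightarrow> 'a" where
  "pos_power x n = ((*) x ^^ (n - 1)) x"

definition n_potent :: "nat \<Rightarrow> 'a::ring itself \<Rightarrow> bool" where
  "n_potent n R \<longleftrightarrow> 2 \<le> n \<and> (\<forall>x::'a. pos_power x n = x)"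

lemma pos_power_1: "pos_power x 1 = x"
  by (simp add: pos_power_def)

lemma pos_power_Suc: "1 \<le> n \<Longrightarrow> pos_power x (Suc n) = x * pos_power x n"
  by (cases n) (simp_all add: pos_power_def)

lemma n_potent_4_iff: "n_potent 4 TYPE('a::ring) \<longleftrightarrow> (\<forall>x::'a. x * x * x * x = x)"
  by (simp add: n_potent_def pos_power_def numeral_eq_Suc mult.assoc)

end

theory Submission
  imports Defs
begin

text \<open>
  Since \<open>- x = (- x)\<^sup>4 = x\<^sup>4 = x\<close>, the ring has characteristic 2, so \<open>x + x\<^sup>2\<close> is idempotent.
  There are no nonzero square-zero elements, so idempotents are central. Linearizing,
  \<open>x y + y x\<close> is central; commuting it with \<open>x\<close> shows that \<open>x\<^sup>2\<close> is central, and hence so is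
  \<open>x = (x + x\<^sup>2) - x\<^sup>2\<close>.
\<close>

text \<open>\<open>e\<close> annihilates \<open>e * x - e * x * e\<close> from the right and
  \<open>x * e - e * x * e\<close> from the left, so both square to zero; hence \<open>e * x\<close>
  and \<open>x * e\<close> both equal \<open>e * x * e\<close>.\<close>

lemma idempotent_central:
  fixes e :: "'a::ring"
  assumes reduced: "\<And>a :: 'a. a * a = 0 \<Longrightarrow> a = 0"
    and idem: "e * e = e"
  shows "e * x = x * e"
proof -
  have idem': "e * (e * z) = e * z" for z
    using idem by (metis mult.assoc)
  have "(e * x - e * x * e) * (e * x - e * x * e) = 0"
    by (simp add: algebra_simps idem idem')
  moreover have "(x * e - e * x * e) * (x * e - e * x * e) = 0"
    by (simp add: algebra_simps idem idem')
  ultimately have "e * x - e * x * e = 0" "x * e - e * x * e = 0"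
    by (blast intro: reduced)+
  then show ?thesis
    by simp
qed

theorem theorem2p11:
  assumes "n_potent 4 TYPE('a::ring)"
  shows "\<forall>x y :: 'a. x * y = y * x"
proof -
  have pot: "x * x * x * x = x" for x :: 'a
    using assms by (simp add: n_potent_4_iff)
  have reduced: "a = 0" if "a * a = 0" for a :: 'a
    using pot[of a] that by simp
  have double: "x + x = 0" for x :: 'a
    using pot[of x] pot[of "- x"] by (simp add: eq_neg_iff_add_eq_0)
  have idem: "(x + x * x) * (x + x * x) = x + x * x" for x :: 'a
  proof -
    have "(x + x * x) * (x + x * x) = x * x + (x * x * x + x * x * x) + x * x * x * x"
      by (simp add: algebra_simps)
    then show ?thesis
      by (simp add: pot double add.commute)
  qed
  have central: "(x + x * x) * z = z * (x + x * x)" for x z :: 'a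
    using idempotent_central[OF reduced idem] .
  have comm_central: "(x * y + y * x) * z = z * (x * y + y * x)" for x y z :: 'a
  proof -
    \<comment> \<open>Polarization of \<open>x + x * x\<close>: the linear terms cancel, leaving a
      combination of central elements.\<close>
    have "x * y + y * x = ((x + y) + (x + y) * (x + y)) - (x + x * x) - (y + y * y)"
      by (simp add: algebra_simps)
    then show ?thesis
      by (simp only: left_diff_distrib right_diff_distrib central)
  qed
  \<comment> \<open>With \<open>z = x\<close> in \<open>comm_central\<close>, the term
    \<open>x * y * x\<close> occurs on both sides and cancels.\<close>
  have square_central: "x * x * y = y * (x * x)" for x y :: 'a
    using comm_central[of x y x] by (simp add: algebra_simps)
  show ?thesis
    using central square_central by (simp add: distrib_left distrib_right)
qed

end
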